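(* Suppose that $a=1$ and $\gamma<0$. Let $N\in\mathbb{N}$ be the integer part of $\frac12-\gamma$, i.e. the unique integer such that $2N\le 1-2\gamma<2N+2$. Then the eigenvalues $\lambda_{1,n}^{\pm},\lambda_{2,n}^{\pm}$ of $\mathcal{A}$ corresponding to $\mu_n^2$ satisfy, as $n\to\infty$, $$\lambda_{1,n}^{\pm}=\begin{cases}\displaystyle \pm i\mu_n+\frac{i\alpha}{2}-\frac{1}{4\mu_n^{-2\gamma}}+O\left(\frac{1}{\mu_n^{\min(1,-4\gamma)}}\right) & \text{if } 0<-2\gamma<1,\\[4mm] \displaystyle \pm i\mu_n+\frac{i\alpha}{2}\pm i\sum_{k=1}^{N}\frac{\alpha_k}{\mu_n^{2k-1}}-\frac{1}{4\mu_n^{-2\gamma}}+O\left(\frac{1}{\mu_n^{\min(2N+1,\,1-2\gamma)}}\right) & \text{if } -2\gamma\ge1,\end{cases}$$ $$\lambda_{2,n}^{\pm}=\begin{cases}\displaystyle \pm i\mu_n-\frac{i\alpha}{2}-\frac{1}{4\mu_n^{-2\gamma}}+O\left(\frac{1}{\mu_n^{\min(1,-4\gamma)}}\right) & \text{if } 0<-2\gamma<1,\\[4mm] \displaystyle \pm i\mu_n-\frac{i\alpha}{2}\pm i\sum_{k=1}^{N}\frac{\alpha_k}{\mu_n^{2k-1}}-\frac{1}{4\mu_n^{-2\gamma}}+O\left(\frac{1}{\mu_n^{\min(2N+1,\,1-2\gamma)}}\right) & \text{if } -2\gamma\ge1,\end{cases}$$ where $\alpha_1=\dfrac{\alpha^2}{8}$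 and $\alpha_k=\dfrac{(2k-3)!\,\alpha^{2k}(-1)^{k-1}}{2^{4k-2}(k-2)!\,k!}$ for all $k\ge2$.
   Context: $H$ is an infinite-dimensional separable complex Hilbert space; $A$ is a self-adjoint, coercive operator in $H$ with compact resolvent and simple spectrum, so there are an orthonormal basis $(e_n)_{n\ge1}$ of $H$ and an increasing sequence of positive numbers $\mu_n\to\infty$ with $Ae_n=\mu_n^2e_n$. Fractional powers of $A$ are defined by spectral calculus. The parameters satisfy $a>0$, $\gamma\le 0$, $\alpha\in\mathbb{R}\setminus\{0\}$. On $\mathcal{H}=D(A^{1/2})\times H\times D(A^{1/2})\times H$, with norm $\|(u,v,y,z)\|_{\mathcal{H}}^2=a\|A^{1/2}u\|^2+\|A^{1/2}y\|^2+\|v\|^2+\|z\|^2$, the operator $\mathcal{A}$ has domain $D(\mathcal{A})=\{(u,v,y,z)\in\mathcal{H}:\ v,z\in D(A^{1/2}),\ u,y\in D(A)\}$ and acts by $\mathcal{A}(u,v,y,z)=(v,\,-aAu-A^{\gamma}v-\alpha z,\,z,\,-Ay+\alpha v)$. The four eigenvalues of $\mathcal{A}$ corresponding to $\mu_n^2$ are the four roots $\lambda$ (counted with multiplicity) of the characteristic equation $$a\mu_n^4+\lambda\left((a+1)\lambda+\mu_n^{2\gamma}\right)\mu_n^2+\lambda^2\left(\lambda^2+\lambda\mu_n^{2\gamma}+\alpha^2\right)=0 .$$ The statement is understood up to a suitable labelling of these roots as $\lambda_{1,n}^{\pm},\lambda_{2,n}^{\pm}$. *)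

theory Defs
  imports
    "HOL-Analysis.Analysis"
    "HOL-Computational_Algebra.Computational_Algebra"
    "HOL-Library.Landau_Symbols"
begin

(* Complex Hilbert spaces; the inner product is linear in its first argument. *)

class complex_hilbert = banach +
  fixes scaleC :: "complex \<Rightarrow> 'a \<Rightarrow> 'a" (infixr "*\<^sub>C" 75)
    and cinner :: "'a \<Rightarrow> 'a \<Rightarrow> complex"
  assumes scaleC_add_right: "c *\<^sub>C (x + y) = c *\<^sub>C x + c *\<^sub>C y"
    and scaleC_add_left: "(c + d) *\<^sub>C x = c *\<^sub>C x + d *\<^sub>C x"
    and scaleC_scaleC: "c *\<^sub>C (d *\<^sub>C x) = (c * d) *\<^sub>C x"
    and scaleC_of_real: "complex_of_real r *\<^sub>C x = scaleR r x"
    and cinner_commute: "cinner x y = cnj (cinner y x)"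
    and cinner_add_left: "cinner (x + y) z = cinner x z + cinner y z"
    and cinner_scaleC_left: "cinner (c *\<^sub>C x) y = c * cinner x y"
    and norm_sq_eq_cinner: "complex_of_real ((norm x)\<^sup>2) = cinner x x"

definition infinite_dimensional :: "'h::complex_hilbert itself \<Rightarrow> bool" where
  "infinite_dimensional _ \<longleftrightarrow>
     \<not> (\<exists>B::'h set. finite B \<and> module.span scaleC B = UNIV)"

definition orthonormal_basis :: "(nat \<Rightarrow> 'h::complex_hilbert) \<Rightarrow> bool" where
  "orthonormal_basis e \<longleftrightarrow>
     (\<forall>m n. cinner (e m) (e n) = (if m = n then 1 else 0)) \<and>
     (\<forall>u. (\<lambda>n. cinner u (e n) *\<^sub>C e n) sums u)"

(* An unbounded operator is given by its domain D and a function T; the values of T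
   outside D are irrelevant. *)

definition linear_operator :: "'h::complex_hilbert set \<Rightarrow> ('h \<Rightarrow> 'h) \<Rightarrow> bool" where
  "linear_operator D T \<longleftrightarrow> 0 \<in> D \<and>
     (\<forall>u\<in>D. \<forall>v\<in>D. u + v \<in> D \<and> T (u + v) = T u + T v) \<and>
     (\<forall>c. \<forall>u\<in>D. c *\<^sub>C u \<in> D \<and> T (c *\<^sub>C u) = c *\<^sub>C T u)"

(* The last conjunct says that the operator and its adjoint have the same graph, so in
   particular the same domain. *)

definition self_adjoint :: "'h::complex_hilbert set \<Rightarrow> ('h \<Rightarrow> 'h) \<Rightarrow> bool" where
  "self_adjoint D T \<longleftrightarrow> linear_operator D T \<and> closure D = UNIV \<and>
     (\<forall>v w. (v \<in> D \<and> T v = w) \<longleftrightarrow> (\<forall>u\<in>D. cinner (T u) v = cinner u w))"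

definition coercive :: "'h::complex_hilbert set \<Rightarrow> ('h \<Rightarrow> 'h) \<Rightarrow> bool" where
  "coercive D T \<longleftrightarrow> (\<exists>c>0. \<forall>u\<in>D. Re (cinner (T u) u) \<ge> c * (norm u)\<^sup>2)"

definition compact_resolvent :: "'h::complex_hilbert set \<Rightarrow> ('h \<Rightarrow> 'h) \<Rightarrow> bool" where
  "compact_resolvent D T \<longleftrightarrow>
     (\<exists>z. bij_betw (\<lambda>u. T u - z *\<^sub>C u) D UNIV \<and>
          compact (closure (inv_into D (\<lambda>u. T u - z *\<^sub>C u) ` cball 0 1)))"

definition eigenspace :: "'h::complex_hilbert set \<Rightarrow> ('h \<Rightarrow> 'h) \<Rightarrow> complex \<Rightarrow> 'h set" where
  "eigenspace D T z = {u \<in> D. T u = z *\<^sub>C u}"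

(* The spectrum of an operator with compact resolvent consists of eigenvalues, so for such
   operators it is enough to bound the dimension of the eigenspaces. *)

definition simple_spectrum :: "'h::complex_hilbert set \<Rightarrow> ('h \<Rightarrow> 'h) \<Rightarrow> bool" where
  "simple_spectrum D T \<longleftrightarrow>
     (\<forall>z. \<forall>u \<in> eigenspace D T z. \<forall>v \<in> eigenspace D T z. u \<noteq> 0 \<longrightarrow> (\<exists>c. v = c *\<^sub>C u))"

(* Spectral calculus for the operator A with A e_n = mu_n^2 e_n: the domain and the values
   of the power A^s. *)

definition frac_dom ::
  "(nat \<Rightarrow> 'h::complex_hilbert) \<Rightarrow> (nat \<Rightarrow> real) \<Rightarrow> real \<Rightarrow> 'h set" where
  "frac_dom e \<mu> s = {u. summable (\<lambda>n. (((\<mu> n)\<^sup>2 powr s) * cmod (cinner u (e n)))\<^sup>2)}"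

definition frac_pow ::
  "(nat \<Rightarrow> 'h::complex_hilbert) \<Rightarrow> (nat \<Rightarrow> real) \<Rightarrow> real \<Rightarrow> 'h \<Rightarrow> 'h" where
  "frac_pow e \<mu> s u = (\<Sum>n. (complex_of_real ((\<mu> n)\<^sup>2 powr s) * cinner u (e n)) *\<^sub>C e n)"

type_synonym 'h state = "'h \<times> 'h \<times> 'h \<times> 'h"

definition energy_space ::
  "(nat \<Rightarrow> 'h::complex_hilbert) \<Rightarrow> (nat \<Rightarrow> real) \<Rightarrow> 'h state set" where
  "energy_space e \<mu> = frac_dom e \<mu> (1/2) \<times> UNIV \<times> frac_dom e \<mu> (1/2) \<times> UNIV"

definition system_dom ::
  "'h::complex_hilbert set \<Rightarrow> (nat \<Rightarrow> 'h) \<Rightarrow> (nat \<Rightarrow> real) \<Rightarrow> 'h state set" where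
  "system_dom D e \<mu> = {(u, v, y, z) \<in> energy_space e \<mu>.
     v \<in> frac_dom e \<mu> (1/2) \<and> z \<in> frac_dom e \<mu> (1/2) \<and> u \<in> D \<and> y \<in> D}"

definition system_op ::
  "real \<Rightarrow> real \<Rightarrow> real \<Rightarrow> ('h::complex_hilbert \<Rightarrow> 'h) \<Rightarrow> (nat \<Rightarrow> 'h) \<Rightarrow> (nat \<Rightarrow> real)
     \<Rightarrow> 'h state \<Rightarrow> 'h state" where
  "system_op a \<gamma> \<alpha> A e \<mu> = (\<lambda>(u, v, y, z).
     (v, - (a *\<^sub>R A u) - frac_pow e \<mu> \<gamma> v - \<alpha> *\<^sub>R z, z, - A y + \<alpha> *\<^sub>R v))"

(* Eigenvalues of the system operator having an eigenvector whose components all lie in the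
   eigenspace of A for the eigenvalue mu_n^2. *)

definition system_eigenvalues ::
  "real \<Rightarrow> real \<Rightarrow> real \<Rightarrow> 'h::complex_hilbert set \<Rightarrow> ('h \<Rightarrow> 'h) \<Rightarrow> (nat \<Rightarrow> 'h) \<Rightarrow> (nat \<Rightarrow> real)
     \<Rightarrow> nat \<Rightarrow> complex set" where
  "system_eigenvalues a \<gamma> \<alpha> D A e \<mu> n = {l. \<exists>u v y z.
     (u, v, y, z) \<in> system_dom D e \<mu> \<and> (u, v, y, z) \<noteq> 0 \<and>
     {u, v, y, z} \<subseteq> eigenspace D A (complex_of_real ((\<mu> n)\<^sup>2)) \<and>
     system_op a \<gamma> \<alpha> A e \<mu> (u, v, y, z) = (l *\<^sub>C u, l *\<^sub>C v, l *\<^sub>C y, l *\<^sub>C z)}"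

(* The left-hand side of the characteristic equation at m = mu_n, as a polynomial in the
   indeterminate X. *)

definition characteristic_poly :: "real \<Rightarrow> real \<Rightarrow> real \<Rightarrow> real \<Rightarrow> complex poly" where
  "characteristic_poly a \<gamma> \<alpha> m =
     (let X = [:0, 1:]; C = (\<lambda>r::real. [:complex_of_real r:]) in
      C (a * m ^ 4) + X * (C (a + 1) * X + C (m powr (2 * \<gamma>))) * C (m\<^sup>2)
      + X\<^sup>2 * (X\<^sup>2 + X * C (m powr (2 * \<gamma>)) + C (\<alpha>\<^sup>2)))"

definition \<alpha>_coeff :: "real \<Rightarrow> nat \<Rightarrow> real" where
  "\<alpha>_coeff \<alpha> k =
     (if k = 1 then \<alpha>\<^sup>2 / 8
      else fact (2 * k - 3) * \<alpha> ^ (2 * k) * (- 1) ^ (k - 1)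
             / (2 ^ (4 * k - 2) * fact (k - 2) * fact k))"

end

theory Submission
  imports Defs
begin

text \<open>
  For \<open>a = 1\<close> the characteristic equation is solvable in closed form. Write \<open>m = \<mu>\<^sub>n\<close> and
  \<open>\<epsilon> = m powr (2 * \<gamma>)\<close>; the equation reads
  \<open>(\<lambda>\<^sup>2 + m\<^sup>2)\<^sup>2 + \<epsilon> \<lambda> (\<lambda>\<^sup>2 + m\<^sup>2) + \<alpha>\<^sup>2 \<lambda>\<^sup>2 = 0\<close>. It is homogeneous in \<open>\<lambda>\<^sup>2 + m\<^sup>2\<close> and \<open>\<lambda>\<close>, so the
  substitution \<open>\<lambda>\<^sup>2 + m\<^sup>2 = w \<lambda>\<close> splits it into two quadratic equations: first
  \<open>w\<^sup>2 + \<epsilon> w + \<alpha>\<^sup>2 = 0\<close>, with the solutions \<open>w = - \<epsilon>/2 \<plusminus> i \<alpha> sqrt (1 - \<epsilon>\<^sup>2/(4 \<alpha>\<^sup>2))\<close>, and then, for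
  each \<open>w\<close>, the equation \<open>\<lambda>\<^sup>2 - w \<lambda> + m\<^sup>2 = 0\<close>, with the solutions
  \<open>\<lambda> = w/2 \<plusminus> i m sqrt (1 - w\<^sup>2/(4 m\<^sup>2))\<close>. The sign in \<open>w\<close> separates \<open>\<lambda>\<^sub>1\<close> from \<open>\<lambda>\<^sub>2\<close>, which
  therefore differ by \<open>\<alpha> \<mapsto> - \<alpha>\<close> only; the sign in \<open>\<lambda>\<close> is the upper index \<open>\<plusminus>\<close>
  (\<open>proots_characteristic_poly\<close>). These roots are the eigenvalues because simplicity of the
  spectrum reduces the eigenvalue problem to a two by two linear system for the coordinates of
  \<open>u\<close> and \<open>y\<close> along \<open>e\<^sub>n\<close>, whose determinant is the characteristic polynomial
  (\<open>system_eigenvalues_eq_roots\<close>).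

  The expansion has three sources of error. Replacing \<open>w/2\<close> by \<open>i \<alpha>/2 - \<epsilon>/4\<close> costs \<open>O(\<epsilon>\<^sup>2)\<close>.
  Since \<open>w\<^sup>2 = - \<alpha>\<^sup>2 - \<epsilon> w\<close>, replacing the second square root by \<open>sqrt (1 + \<alpha>\<^sup>2/(4 m\<^sup>2))\<close> costs
  \<open>O(\<epsilon>/m)\<close> (\<open>pair_root_approx\<close>). Finally, \<open>m sqrt (1 + \<alpha>\<^sup>2/(4 m\<^sup>2))\<close> is expanded by the binomial
  series, whose coefficients are the \<open>\<alpha>\<^sub>k\<close>, and cutting it off after \<open>N\<close> terms costs
  \<open>O(m powr (- (2 N + 1)))\<close> (\<open>scaled_sqrt_expansion\<close>). As \<open>\<epsilon>\<^sup>2 = m powr (4 \<gamma>)\<close> and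
  \<open>\<epsilon>/m = m powr (2 \<gamma> - 1)\<close>, all three are within the claimed error: if \<open>- 2 \<gamma> < 1\<close> then \<open>N = 0\<close>, so
  that the errors are \<open>O(m powr (4 \<gamma>))\<close> and \<open>O(1/m)\<close>; if \<open>- 2 \<gamma> \<ge> 1\<close> then \<open>\<epsilon>\<^sup>2\<close> is at most \<open>\<epsilon>/m\<close> for
  \<open>m \<ge> 1\<close>.
\<close>

section \<open>The eigenvalue problem in coordinates\<close>

lemma scaleC_zero_left [simp]: "0 *\<^sub>C x = 0"
  using scaleC_of_real[of 0 x] by simp

lemma scaleC_one [simp]: "1 *\<^sub>C x = x"
  using scaleC_of_real[of 1 x] by simp

lemma scaleC_minus_left: "(- c) *\<^sub>C x = - (c *\<^sub>C x)"
  using scaleC_add_left[of c "- c" x] by (simp add: eq_neg_iff_add_eq_0 add.commute)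

lemma scaleC_diff_left: "(c - d) *\<^sub>C x = c *\<^sub>C x - d *\<^sub>C x"
  using scaleC_add_left[of c "- d" x] by (simp add: scaleC_minus_left)

lemma orthonormal_basis_cinner:
  assumes "orthonormal_basis e"
  shows "cinner (c *\<^sub>C e m) (e n) = (if m = n then c else 0)"
  using assms by (simp add: orthonormal_basis_def cinner_scaleC_left)

lemma orthonormal_basis_scaleC_eq_iff:
  assumes "orthonormal_basis e"
  shows "c *\<^sub>C e n = d *\<^sub>C e n \<longleftrightarrow> c = d"
  by (metis assms orthonormal_basis_cinner)

lemma orthonormal_basis_nonzero:
  assumes "orthonormal_basis e"
  shows "e n \<noteq> 0"
  using orthonormal_basis_scaleC_eq_iff[OF assms, of 1 n 0] by auto

lemma frac_pow_basis:
  assumes "orthonormal_basis e" "\<mu> n > 0"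
  shows "frac_pow e \<mu> s (c *\<^sub>C e n) = (complex_of_real (\<mu> n powr (2 * s)) * c) *\<^sub>C e n"
proof -
  have "frac_pow e \<mu> s (c *\<^sub>C e n)
      = (\<Sum>k\<in>{n}. (complex_of_real ((\<mu> k)\<^sup>2 powr s) * cinner (c *\<^sub>C e n) (e k)) *\<^sub>C e k)"
    unfolding frac_pow_def
    by (rule suminf_finite) (auto simp: orthonormal_basis_cinner[OF assms(1)])
  moreover have "(\<mu> n)\<^sup>2 powr s = \<mu> n powr (2 * s)"
    using assms(2) by (simp add: powr_powr flip: powr_numeral)
  ultimately show ?thesis
    by (simp add: orthonormal_basis_cinner[OF assms(1)])
qed

lemma frac_dom_basis:
  assumes "orthonormal_basis e"
  shows "c *\<^sub>C e n \<in> frac_dom e \<mu> s"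
  unfolding frac_dom_def
  by (auto intro!: summable_finite[of "{n}"] simp: orthonormal_basis_cinner[OF assms] split: if_splits)

text \<open>This is where simplicity of the spectrum enters: it turns eigenvectors into scalar coordinates.\<close>
lemma eigenspace_eq_multiples:
  assumes "linear_operator D A" "simple_spectrum D A" "orthonormal_basis e"
    and "e n \<in> D" "A (e n) = z *\<^sub>C e n"
  shows "eigenspace D A z = range (\<lambda>c. c *\<^sub>C e n)"
proof -
  have "e n \<in> eigenspace D A z"
    using assms by (simp add: eigenspace_def)
  then have "eigenspace D A z \<subseteq> range (\<lambda>c. c *\<^sub>C e n)"
    using assms(2) orthonormal_basis_nonzero[OF assms(3), of n]
    unfolding simple_spectrum_def by blast
  moreover have "c *\<^sub>C e n \<in> eigenspace D A z" for c
    using assms by (simp add: eigenspace_def linear_operator_def scaleC_scaleC mult.commute)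
  ultimately show ?thesis by auto
qed

lemma poly_characteristic_poly:
  "poly (characteristic_poly a \<gamma> \<alpha> m) l
     = (l\<^sup>2 + m\<^sup>2) * (l\<^sup>2 + complex_of_real (m powr (2 * \<gamma>)) * l + a * m\<^sup>2)
         + (\<alpha> * l)\<^sup>2"
  unfolding characteristic_poly_def Let_def
  by (simp add: algebra_simps power2_eq_square power4_eq_xxxx)

text \<open>
  The system for the coordinates \<open>c\<close> of \<open>u\<close> and \<open>d\<close> of \<open>y\<close> has determinant \<open>q p + r\<^sup>2\<close>. The
  coefficient \<open>r = \<alpha> \<lambda>\<close> is nonzero, so a kernel vector can be written down at once, namely
  \<open>(q, r)\<close>.
\<close>
lemma pencil_singular_iff:
  fixes p q r :: complex
  assumes "r \<noteq> 0"
  shows "(\<exists>c d. (c \<noteq> 0 \<or> d \<noteq> 0) \<and> p * c + r * d = 0 \<and> q * d = r * c) \<longleftrightarrow> q * p + r\<^sup>2 = 0"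
proof
  assume "\<exists>c d. (c \<noteq> 0 \<or> d \<noteq> 0) \<and> p * c + r * d = 0 \<and> q * d = r * c"
  then obtain c d where cd: "c \<noteq> 0 \<or> d \<noteq> 0" "p * c + r * d = 0" "q * d = r * c" by blast
  have "(q * p + r\<^sup>2) * c = q * (p * c + r * d) - r * (q * d - r * c)"
    "(q * p + r\<^sup>2) * d = r * (p * c + r * d) + p * (q * d - r * c)"
    by (simp_all add: algebra_simps power2_eq_square)
  then have "(q * p + r\<^sup>2) * c = 0" "(q * p + r\<^sup>2) * d = 0" by (simp_all add: cd)
  with cd(1) show "q * p + r\<^sup>2 = 0" by auto
next
  assume "q * p + r\<^sup>2 = 0"
  then have "p * q + r * r = 0" "q * r = r * q" by (simp_all add: power2_eq_square mult.commute)
  \<comment> \<open>The kernel vector is \<open>c = q\<close>, \<open>d = r\<close>.\<close>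
  with assms show "\<exists>c d. (c \<noteq> 0 \<or> d \<noteq> 0) \<and> p * c + r * d = 0 \<and> q * d = r * c"
    by blast
qed

text \<open>
  On the span of \<open>e\<^sub>n\<close> the first and third rows of the eigenvalue equation give \<open>v = \<lambda> u\<close> and
  \<open>z = \<lambda> y\<close>, and what remains is a two by two system for \<open>u\<close> and \<open>y\<close> with the characteristic
  polynomial as its determinant.
\<close>
lemma system_eigenvalues_eq_roots:
  assumes lin: "linear_operator D A" and simp: "simple_spectrum D A" and e: "orthonormal_basis e"
    and en: "e n \<in> D" "A (e n) = complex_of_real ((\<mu> n)\<^sup>2) *\<^sub>C e n"
    and "\<mu> n > 0" "\<alpha> \<noteq> 0" "a > 0"
  shows "system_eigenvalues a \<gamma> \<alpha> D A e \<mu> n = {l. poly (characteristic_poly a \<gamma> \<alpha> (\<mu> n)) l = 0}"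
proof (rule set_eqI)
  fix l
  define m where "m = complex_of_real (\<mu> n)"
  define \<epsilon> where "\<epsilon> = complex_of_real (\<mu> n powr (2 * \<gamma>))"
  define E where "E = eigenspace D A (complex_of_real ((\<mu> n)\<^sup>2))"
  have E: "E = range (\<lambda>c. c *\<^sub>C e n)"
    unfolding E_def by (rule eigenspace_eq_multiples[OF lin simp e en])
  have inD: "c *\<^sub>C e n \<in> D" for c
    using lin en(1) by (simp add: linear_operator_def)
  have A: "A (c *\<^sub>C e n) = (m\<^sup>2 * c) *\<^sub>C e n" for c
    using lin en by (simp add: linear_operator_def scaleC_scaleC mult.commute m_def)
  have op: "system_op a \<gamma> \<alpha> A e \<mu> (c *\<^sub>C e n, c' *\<^sub>C e n, d *\<^sub>C e n, d' *\<^sub>C e n)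
      = (c' *\<^sub>C e n, (- a * m\<^sup>2 * c - \<epsilon> * c' - \<alpha> * d') *\<^sub>C e n,
         d' *\<^sub>C e n, (- m\<^sup>2 * d + \<alpha> * c') *\<^sub>C e n)" for c c' d d' :: complex
    unfolding system_op_def prod.case A frac_pow_basis[of e \<mu> n, OF e \<open>\<mu> n > 0\<close>]
    by (simp add: scaleC_diff_left scaleC_add_left scaleC_minus_left \<epsilon>_def mult.assoc
             flip: scaleC_of_real scaleC_scaleC)
  have "l \<in> system_eigenvalues a \<gamma> \<alpha> D A e \<mu> n \<longleftrightarrow>
     (\<exists>(c::complex) (c'::complex) (d::complex) (d'::complex). (c *\<^sub>C e n, c' *\<^sub>C e n, d *\<^sub>C e n, d' *\<^sub>C e n) \<noteq> 0 \<and>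
        system_op a \<gamma> \<alpha> A e \<mu> (c *\<^sub>C e n, c' *\<^sub>C e n, d *\<^sub>C e n, d' *\<^sub>C e n)
          = (l *\<^sub>C c *\<^sub>C e n, l *\<^sub>C c' *\<^sub>C e n, l *\<^sub>C d *\<^sub>C e n, l *\<^sub>C d' *\<^sub>C e n))"
    (is "_ \<longleftrightarrow> ?coords")
  proof
    assume "l \<in> system_eigenvalues a \<gamma> \<alpha> D A e \<mu> n"
    then obtain u v y z where "(u, v, y, z) \<noteq> 0" "u \<in> E" "v \<in> E" "y \<in> E" "z \<in> E"
      and "system_op a \<gamma> \<alpha> A e \<mu> (u, v, y, z) = (l *\<^sub>C u, l *\<^sub>C v, l *\<^sub>C y, l *\<^sub>C z)"
      by (auto simp: system_eigenvalues_def E_def)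
    then show ?coords
      by (auto simp only: E image_iff)
  next
    assume ?coords
    then obtain c c' d d' where eig: "(c *\<^sub>C e n, c' *\<^sub>C e n, d *\<^sub>C e n, d' *\<^sub>C e n) \<noteq> 0"
      "system_op a \<gamma> \<alpha> A e \<mu> (c *\<^sub>C e n, c' *\<^sub>C e n, d *\<^sub>C e n, d' *\<^sub>C e n)
         = (l *\<^sub>C c *\<^sub>C e n, l *\<^sub>C c' *\<^sub>C e n, l *\<^sub>C d *\<^sub>C e n, l *\<^sub>C d' *\<^sub>C e n)"
      by blast
    moreover have "(c *\<^sub>C e n, c' *\<^sub>C e n, d *\<^sub>C e n, d' *\<^sub>C e n) \<in> system_dom D e \<mu>"
      by (simp add: system_dom_def energy_space_def inD frac_dom_basis[OF e])
    moreover have "{c *\<^sub>C e n, c' *\<^sub>C e n, d *\<^sub>C e n, d' *\<^sub>C e n} \<subseteq> E"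
      by (auto simp: E)
    ultimately show "l \<in> system_eigenvalues a \<gamma> \<alpha> D A e \<mu> n"
      unfolding system_eigenvalues_def E_def by (intro CollectI exI conjI)
  qed
  also have "\<dots> \<longleftrightarrow> (\<exists>(c::complex) (c'::complex) (d::complex) (d'::complex). (c \<noteq> 0 \<or> c' \<noteq> 0 \<or> d \<noteq> 0 \<or> d' \<noteq> 0) \<and>
        c' = l * c \<and> - a * m\<^sup>2 * c - \<epsilon> * c' - \<alpha> * d' = l * c' \<and>
        d' = l * d \<and> - m\<^sup>2 * d + \<alpha> * c' = l * d')"
    using orthonormal_basis_scaleC_eq_iff[OF e] orthonormal_basis_scaleC_eq_iff[OF e, of _ n 0]
    by (simp add: op zero_prod_def scaleC_scaleC)
  also have "\<dots> \<longleftrightarrow> (\<exists>c d. (c \<noteq> 0 \<or> d \<noteq> 0) \<and>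
        (l\<^sup>2 + \<epsilon> * l + a * m\<^sup>2) * c + (\<alpha> * l) * d = 0 \<and> (l\<^sup>2 + m\<^sup>2) * d = (\<alpha> * l) * c)"
  proof -
    have 1: "- a * m\<^sup>2 * c - \<epsilon> * (l * c) - \<alpha> * (l * d) = l * (l * c) \<longleftrightarrow>
        (l\<^sup>2 + \<epsilon> * l + a * m\<^sup>2) * c + (\<alpha> * l) * d = 0" for c d
    proof -
      have "(l\<^sup>2 + \<epsilon> * l + a * m\<^sup>2) * c + (\<alpha> * l) * d
          = l * (l * c) - (- a * m\<^sup>2 * c - \<epsilon> * (l * c) - \<alpha> * (l * d))"
        by (simp add: algebra_simps power2_eq_square)
      then show ?thesis by (metis right_minus_eq)
    qed
    have 2: "- m\<^sup>2 * d + \<alpha> * (l * c) = l * (l * d) \<longleftrightarrow> (l\<^sup>2 + m\<^sup>2) * d = (\<alpha> * l) * c" for c d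
    proof -
      have "(l\<^sup>2 + m\<^sup>2) * d - (\<alpha> * l) * c = l * (l * d) - (- m\<^sup>2 * d + \<alpha> * (l * c))"
        by (simp add: algebra_simps power2_eq_square)
      then show ?thesis by (metis right_minus_eq)
    qed
    show ?thesis
      unfolding 1[symmetric] 2[symmetric] by auto
  qed
  \<comment> \<open>Here \<open>l = 0\<close> is neither a root nor an eigenvalue, because \<open>a m\<^sup>4 > 0\<close>.\<close>
  also have "\<dots> \<longleftrightarrow> poly (characteristic_poly a \<gamma> \<alpha> (\<mu> n)) l = 0"
  proof (cases "l = 0")
    case True
    with assms show ?thesis
      by (auto simp: poly_characteristic_poly m_def)
  next
    case False
    then show ?thesis
      using pencil_singular_iff[of "\<alpha> * l" "l\<^sup>2 + \<epsilon> * l + a * m\<^sup>2" "l\<^sup>2 + m\<^sup>2"] \<open>\<alpha> \<noteq> 0\<close>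
      by (simp add: poly_characteristic_poly m_def \<epsilon>_def)
  qed
  finally show "l \<in> system_eigenvalues a \<gamma> \<alpha> D A e \<mu> n \<longleftrightarrow>
      l \<in> {l. poly (characteristic_poly a \<gamma> \<alpha> (\<mu> n)) l = 0}"
    by simp
qed

section \<open>Explicit roots of the characteristic polynomial\<close>

text \<open>
  The root of \<open>w\<^sup>2 + \<epsilon> w + \<beta>\<^sup>2 = 0\<close> that tends to \<open>i \<beta>\<close> as \<open>\<epsilon> \<rightarrow> 0\<close>; the other root is obtained by
  changing the sign of \<open>\<beta>\<close>. It is the sum of a pair of eigenvalues with product \<open>m\<^sup>2\<close>.
\<close>
definition pair_sum :: "real \<Rightarrow> real \<Rightarrow> complex" where
  "pair_sum \<beta> \<epsilon> = \<i> * \<beta> * csqrt (1 - (\<epsilon> / (2 * \<beta>))\<^sup>2) - \<epsilon> / 2"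

text \<open>The roots of \<open>\<lambda>\<^sup>2 - w \<lambda> + m\<^sup>2 = 0\<close>, where \<open>s = \<plusminus> 1\<close> selects the one that is
  \<open>s i m + O(1)\<close> for bounded \<open>w\<close> and large \<open>m\<close>.\<close>
definition pair_root :: "real \<Rightarrow> complex \<Rightarrow> real \<Rightarrow> complex" where
  "pair_root m w s = w / 2 + s * \<i> * m * csqrt (1 - (w / (2 * m))\<^sup>2)"

lemma pair_sum_add: "pair_sum \<beta> \<epsilon> + pair_sum (- \<beta>) \<epsilon> = - \<epsilon>"
  by (simp add: pair_sum_def)

lemma pair_sum_mult:
  assumes "\<beta> \<noteq> 0"
  shows "pair_sum \<beta> \<epsilon> * pair_sum (- \<beta>) \<epsilon> = \<beta>\<^sup>2"
proof -
  define q where "q = csqrt (1 - (\<epsilon> / (2 * \<beta>))\<^sup>2)"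
  have q: "q\<^sup>2 = 1 - (\<epsilon> / (2 * \<beta>))\<^sup>2"
    by (simp add: q_def)
  have "pair_sum \<beta> \<epsilon> = \<i> * \<beta> * q - \<epsilon> / 2" "pair_sum (- \<beta>) \<epsilon> = - \<i> * \<beta> * q - \<epsilon> / 2"
    by (simp_all add: pair_sum_def q_def)
  note pair = this
  have "pair_sum \<beta> \<epsilon> * pair_sum (- \<beta>) \<epsilon> = \<beta>\<^sup>2 * q\<^sup>2 + (\<epsilon> / 2)\<^sup>2"
    unfolding pair by (simp add: algebra_simps power2_eq_square)
  also have "\<dots> = \<beta>\<^sup>2"
    unfolding q using assms by (simp add: power_divide power_mult_distrib right_diff_distrib)
  finally show ?thesis .
qed

lemma pair_sum_square:
  assumes "\<beta> \<noteq> 0"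
  shows "(pair_sum \<beta> \<epsilon>)\<^sup>2 + \<beta>\<^sup>2 = - \<epsilon> * pair_sum \<beta> \<epsilon>"
proof -
  define w w' where "w = pair_sum \<beta> \<epsilon>" and "w' = pair_sum (- \<beta>) \<epsilon>"
  have "- complex_of_real \<epsilon> = w + w'" "(complex_of_real \<beta>)\<^sup>2 = w * w'"
    using pair_sum_add pair_sum_mult[OF assms] by (simp_all add: w_def w'_def)
  then show ?thesis
    by (simp add: algebra_simps power2_eq_square flip: w_def)
qed

lemma pair_root_factorization:
  assumes "m \<noteq> 0"
  shows "[:complex_of_real (m\<^sup>2), - w, 1:] = [:- pair_root m w 1, 1:] * [:- pair_root m w (- 1), 1:]"
proof -
  define q where "q = csqrt (1 - (w / (2 * m))\<^sup>2)"
  have q: "q\<^sup>2 = 1 - (w / (2 * m))\<^sup>2"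
    by (simp add: q_def)
  have "pair_root m w 1 = w / 2 + \<i> * m * q" "pair_root m w (- 1) = w / 2 - \<i> * m * q"
    by (simp_all add: pair_root_def q_def)
  note modes = this
  have "pair_root m w 1 * pair_root m w (- 1) = (w / 2)\<^sup>2 + m\<^sup>2 * q\<^sup>2"
    unfolding modes by (simp add: algebra_simps power2_eq_square)
  also have "\<dots> = m\<^sup>2"
    unfolding q using assms by (simp add: power_divide power_mult_distrib right_diff_distrib)
  finally have prod: "m\<^sup>2 = pair_root m w 1 * pair_root m w (- 1)"
    by simp
  have sum: "w = pair_root m w 1 + pair_root m w (- 1)"
    by (simp add: pair_root_def)
  define r r' where "r = pair_root m w 1" and "r' = pair_root m w (- 1)"
  have "complex_of_real m ^ 2 = r * r'" "w = r + r'"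
    using prod sum by (simp_all add: r_def r'_def)
  then have "[:complex_of_real (m\<^sup>2), - w, 1:] = [:- r, 1:] * [:- r', 1:]"
    by simp
  then show ?thesis
    by (simp only: r_def r'_def)
qed

text \<open>
  With \<open>w + w' = - \<epsilon>\<close> and \<open>w w' = \<alpha>\<^sup>2\<close>, the product \<open>(P - w X) (P - w' X)\<close> for \<open>P = X\<^sup>2 + m\<^sup>2\<close> is
  \<open>P\<^sup>2 + \<epsilon> X P + \<alpha>\<^sup>2 X\<^sup>2\<close>; it is \<open>a = 1\<close> that makes the characteristic polynomial a quadratic form
  in \<open>P\<close> and \<open>X\<close>.
\<close>
lemma characteristic_poly_factorization:
  assumes "\<alpha> \<noteq> 0"
  shows "characteristic_poly 1 \<gamma> \<alpha> m =
    [:complex_of_real (m\<^sup>2), - pair_sum \<alpha> (m powr (2 * \<gamma>)), 1:] *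
    [:complex_of_real (m\<^sup>2), - pair_sum (- \<alpha>) (m powr (2 * \<gamma>)), 1:]"
proof -
  define \<epsilon> where "\<epsilon> = m powr (2 * \<gamma>)"
  define w w' where "w = pair_sum \<alpha> \<epsilon>" and "w' = pair_sum (- \<alpha>) \<epsilon>"
  have [simp]: "complex_of_real \<epsilon> = - (w + w')" and "complex_of_real \<alpha> ^ 2 = w * w'"
    using pair_sum_add pair_sum_mult[OF assms] by (simp_all add: w_def w'_def)
  then show ?thesis
    unfolding characteristic_poly_def Let_def \<epsilon>_def[symmetric] w_def[symmetric] w'_def[symmetric]
    by (simp add: algebra_simps power2_eq_square power4_eq_xxxx)
qed

lemma proots_characteristic_poly:
  fixes \<alpha> \<gamma> m :: real
  assumes "\<alpha> \<noteq> 0" "m \<noteq> 0"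
  defines "w \<equiv> (\<lambda>\<beta>. pair_sum \<beta> (m powr (2 * \<gamma>)))"
  shows "proots (characteristic_poly 1 \<gamma> \<alpha> m) =
    {#pair_root m (w \<alpha>) 1, pair_root m (w \<alpha>) (- 1),
      pair_root m (w (- \<alpha>)) 1, pair_root m (w (- \<alpha>)) (- 1)#}"
proof -
  have "proots [:complex_of_real (m\<^sup>2), - w \<beta>, 1:] = {#pair_root m (w \<beta>) 1, pair_root m (w \<beta>) (- 1)#}" for \<beta>
    unfolding pair_root_factorization[OF assms(2)] by (subst proots_mult) auto
  then show ?thesis
    unfolding characteristic_poly_factorization[OF assms(1)] w_def by (subst proots_mult) auto
qed

section \<open>Approximation of the roots for weak damping\<close>

text \<open>
  The difference of the roots is the difference of the arguments divided by the sum of the roots.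
  The principal branch has nonnegative real part, so this sum has modulus at least \<open>sqrt r\<close>.
\<close>
lemma cmod_csqrt_diff_le:
  assumes "r > 0"
  shows "cmod (csqrt z - sqrt r) \<le> cmod (z - r) / sqrt r"
proof -
  have "sqrt r \<le> Re (csqrt z + sqrt r)"
    using Re_csqrt[of z] by simp
  also have "\<dots> \<le> cmod (csqrt z + sqrt r)"
    by (rule complex_Re_le_cmod)
  finally have "cmod (csqrt z - sqrt r) * sqrt r
      \<le> cmod (csqrt z - sqrt r) * cmod (csqrt z + sqrt r)"
    by (rule mult_left_mono) simp
  also have "\<dots> = cmod ((csqrt z)\<^sup>2 - (complex_of_real (sqrt r))\<^sup>2)"
    by (simp add: square_diff_square_factored power2_eq_square mult.commute flip: norm_mult)
  also have "\<dots> = cmod (z - r)"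
    using assms by (simp flip: of_real_power)
  finally show ?thesis
    using assms by (simp add: field_simps)
qed

lemma pair_sum_approx:
  assumes "\<beta> \<noteq> 0"
  shows "cmod (pair_sum \<beta> \<epsilon> - (\<i> * \<beta> - \<epsilon> / 2)) \<le> \<epsilon>\<^sup>2 / (4 * \<bar>\<beta>\<bar>)"
proof -
  define z where "z = 1 - (complex_of_real \<epsilon> / (2 * \<beta>))\<^sup>2"
  have "pair_sum \<beta> \<epsilon> - (\<i> * \<beta> - \<epsilon> / 2) = \<i> * \<beta> * (csqrt z - sqrt 1)"
    by (simp add: pair_sum_def z_def algebra_simps)
  then have "cmod (pair_sum \<beta> \<epsilon> - (\<i> * \<beta> - \<epsilon> / 2)) = \<bar>\<beta>\<bar> * cmod (csqrt z - sqrt 1)"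
    by (simp only: norm_mult norm_ii norm_of_real mult_1)
  also have "\<dots> \<le> \<bar>\<beta>\<bar> * cmod (z - 1)"
    using cmod_csqrt_diff_le[of 1 z] by (intro mult_left_mono) auto
  also have "cmod (z - 1) = (\<epsilon> / (2 * \<beta>))\<^sup>2"
    by (simp add: z_def norm_power norm_divide norm_mult power_divide power_mult_distrib)
  also have "\<bar>\<beta>\<bar> * (\<epsilon> / (2 * \<beta>))\<^sup>2 = \<epsilon>\<^sup>2 / (4 * \<bar>\<beta>\<bar>)"
    using assms by (cases "\<beta> > 0") (auto simp: field_simps power2_eq_square)
  finally show ?thesis .
qed

text \<open>
  The first error term comes from \<open>w/2\<close>. The second one comes from the square root: its argument
  is moved by \<open>- (w\<^sup>2 + \<beta>\<^sup>2)/(4 m\<^sup>2) = \<epsilon> w/(4 m\<^sup>2)\<close>, which gains a factor \<open>\<epsilon>\<close>, and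
  \<open>\<bar>\<beta>\<bar> + 1/2 + 1/(4 \<bar>\<beta>\<bar>)\<close> bounds \<open>w\<close>.
\<close>
lemma pair_root_approx:
  assumes "\<beta> \<noteq> 0" "0 \<le> \<epsilon>" "\<epsilon> \<le> 1" "m > 0" "\<bar>s\<bar> = 1"
  shows "cmod (pair_root m (pair_sum \<beta> \<epsilon>) s
           - (s * \<i> * m * sqrt (1 + (\<beta> / (2 * m))\<^sup>2) + \<i> * \<beta> / 2 - \<epsilon> / 4))
         \<le> \<epsilon>\<^sup>2 / (8 * \<bar>\<beta>\<bar>) + (\<bar>\<beta>\<bar> + 1 / 2 + 1 / (4 * \<bar>\<beta>\<bar>)) / 4 * (\<epsilon> / m)"
proof -
  define w where "w = pair_sum \<beta> \<epsilon>"
  define z r where "z = 1 - (w / (2 * m))\<^sup>2" and "r = 1 + (\<beta> / (2 * m))\<^sup>2"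
  have w: "cmod (w - (\<i> * \<beta> - \<epsilon> / 2)) \<le> \<epsilon>\<^sup>2 / (4 * \<bar>\<beta>\<bar>)"
    unfolding w_def by (rule pair_sum_approx[OF assms(1)])
  have "cmod w \<le> cmod (\<i> * \<beta>) + cmod (complex_of_real (\<epsilon> / 2)) + cmod (w - (\<i> * \<beta> - \<epsilon> / 2))"
    using norm_triangle_ineq[of "w - (\<i> * \<beta> - \<epsilon> / 2)" "\<i> * \<beta> - \<epsilon> / 2"]
      norm_triangle_ineq4[of "\<i> * \<beta>" "complex_of_real (\<epsilon> / 2)"] by simp
  also have "\<dots> \<le> \<bar>\<beta>\<bar> + \<epsilon> / 2 + \<epsilon>\<^sup>2 / (4 * \<bar>\<beta>\<bar>)"
    using w assms(2) by (simp add: norm_mult)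
  also have "\<dots> \<le> \<bar>\<beta>\<bar> + 1 / 2 + 1 / (4 * \<bar>\<beta>\<bar>)"
    using assms(2,3) by (intro add_mono divide_right_mono) (auto intro: power_le_one)
  finally have w_bound: "cmod w \<le> \<bar>\<beta>\<bar> + 1 / 2 + 1 / (4 * \<bar>\<beta>\<bar>)" .
  have r: "r \<ge> 1"
    by (simp add: r_def)
  have "z - r = - (w\<^sup>2 + \<beta>\<^sup>2) / (4 * m\<^sup>2)"
    using assms(4) by (simp add: z_def r_def field_simps)
  also have "w\<^sup>2 + \<beta>\<^sup>2 = - \<epsilon> * w"
    using pair_sum_square[OF assms(1), of \<epsilon>] by (simp add: w_def)
  finally have zr: "cmod (z - r) = \<epsilon> * cmod w / (4 * m\<^sup>2)"
    using assms(2) by (simp add: norm_divide norm_mult norm_power)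
  have "cmod (csqrt z - sqrt r) \<le> cmod (z - r) / sqrt r"
    using r by (intro cmod_csqrt_diff_le) simp
  also have "\<dots> \<le> cmod (z - r)"
    using r divide_left_mono[of 1 "sqrt r" "cmod (z - r)"] by simp
  finally have "m * cmod (csqrt z - sqrt r) \<le> m * (\<epsilon> * cmod w / (4 * m\<^sup>2))"
    using assms(4) by (intro mult_left_mono) (simp_all add: zr)
  also have "\<dots> = cmod w / 4 * (\<epsilon> / m)"
    using assms(4) by (simp add: field_simps power2_eq_square)
  also have "\<dots> \<le> (\<bar>\<beta>\<bar> + 1 / 2 + 1 / (4 * \<bar>\<beta>\<bar>)) / 4 * (\<epsilon> / m)"
    using w_bound assms(2,4) by (intro mult_right_mono divide_right_mono) auto
  finally have root: "m * cmod (csqrt z - sqrt r)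
      \<le> (\<bar>\<beta>\<bar> + 1 / 2 + 1 / (4 * \<bar>\<beta>\<bar>)) / 4 * (\<epsilon> / m)" .
  have "pair_root m w s - (s * \<i> * m * sqrt r + \<i> * \<beta> / 2 - \<epsilon> / 4)
      = (w - (\<i> * \<beta> - \<epsilon> / 2)) / 2 + s * \<i> * m * (csqrt z - sqrt r)"
    by (simp add: pair_root_def z_def field_simps)
  also have "cmod \<dots> \<le> cmod ((w - (\<i> * \<beta> - \<epsilon> / 2)) / 2) + cmod (s * \<i> * m * (csqrt z - sqrt r))"
    by (rule norm_triangle_ineq)
  also have "\<dots> = cmod (w - (\<i> * \<beta> - \<epsilon> / 2)) / 2 + m * cmod (csqrt z - sqrt r)"
    using assms(4,5) by (simp only: norm_mult norm_divide norm_of_real norm_ii) simp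
  also have "\<dots> \<le> \<epsilon>\<^sup>2 / (8 * \<bar>\<beta>\<bar>) + (\<bar>\<beta>\<bar> + 1 / 2 + 1 / (4 * \<bar>\<beta>\<bar>)) / 4 * (\<epsilon> / m)"
    using w root by (intro add_mono) auto
  finally show ?thesis
    by (simp add: w_def r_def)
qed

section \<open>Binomial expansion of the square root\<close>

lemma gbinomial_Suc_rec:
  fixes a :: "'a::field_char_0"
  shows "a gchoose Suc k = (a gchoose k) * (a - of_nat k) / of_nat (Suc k)"
proof -
  have "of_nat (Suc k) * (a gchoose Suc k) = (a gchoose k) * (a - of_nat k)"
    using gbinomial_mult_1[of a k] by (simp add: algebra_simps del: of_nat_Suc)
  then show ?thesis
    by (simp add: eq_divide_eq mult.commute del: of_nat_Suc)
qed

text \<open>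
  Consecutive coefficients have the ratio \<open>(1/2 - k)/(k + 1)\<close>, of modulus at most \<open>1\<close>. This bound
  lets a geometric series control the tail of the binomial series.
\<close>
lemma abs_half_gbinomial_le_1: "\<bar>(1/2 :: real) gchoose k\<bar> \<le> 1"
proof (induction k)
  case (Suc k)
  have "\<bar>(1/2 - real k) / real (Suc k)\<bar> \<le> 1"
    by (simp add: abs_divide divide_le_eq_1)
  then have "\<bar>(1/2 :: real) gchoose k\<bar> * \<bar>(1/2 - real k) / real (Suc k)\<bar> \<le> 1 * 1"
    using Suc by (intro mult_mono) auto
  then show ?case
    by (simp only: gbinomial_Suc_rec abs_mult[symmetric] times_divide_eq_right mult_1)
qed simp

text \<open>
  Both sides satisfy the same recursion: passing from \<open>k\<close> to \<open>k + 1\<close> multiplies them by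
  \<open>(1/2 - k)/(k + 1) \<cdot> (\<alpha>/2)\<^sup>2\<close>. The factorial formula applies from \<open>k = 2\<close> on, where the
  induction starts.
\<close>
lemma \<alpha>_coeff_eq_gbinomial:
  assumes "k \<ge> 1"
  shows "\<alpha>_coeff \<alpha> k = ((1/2) gchoose k) * (\<alpha> / 2) ^ (2 * k)"
proof (cases "k = 1")
  case True
  then show ?thesis
    by (simp add: \<alpha>_coeff_def power2_eq_square)
next
  case False
  with assms obtain j where "k = j + 2"
    using nat_le_iff_add[of 2 k] by auto
  moreover have "\<alpha>_coeff \<alpha> (j + 2) = ((1/2) gchoose (j + 2)) * (\<alpha> / 2) ^ (2 * (j + 2))"
  proof (induction j)
    case 0
    have "(1/2 :: real) gchoose 2 = - 1 / 8"
      by (simp add: gbinomial_Suc_rec numeral_2_eq_2)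
    then show ?case
      by (simp add: \<alpha>_coeff_def power_divide fact_numeral numeral_2_eq_2[symmetric])
  next
    case (Suc j)
    have "\<alpha>_coeff \<alpha> (j + 3) = \<alpha>_coeff \<alpha> (j + 2) * ((1/2 - real (j + 2)) / real (j + 3) * (\<alpha> / 2)\<^sup>2)"
    proof -
      define c where "c = fact (2 * j + 1) * \<alpha> ^ (2 * (j + 2)) * (- 1) ^ (j + 1)
          / (2 ^ (4 * j + 6) * fact j * fact (j + 2))"
      have "\<alpha>_coeff \<alpha> (j + 2) = c"
        by (simp add: \<alpha>_coeff_def c_def)
      have f: "fact (2 * j + 3) = (real (2 * j + 3) * real (2 * j + 2)) * fact (2 * j + 1)"
        "fact (j + 1) = real (j + 1) * fact j" "fact (j + 3) = real (j + 3) * fact (j + 2)"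
        by (simp_all add: eval_nat_numeral)
      have "\<alpha>_coeff \<alpha> (j + 3) = fact (2 * j + 3) * \<alpha> ^ (2 * (j + 2) + 2) * (- 1) ^ (j + 1 + 1)
          / (2 ^ (4 * j + 6 + 4) * fact (j + 1) * fact (j + 3))"
        by (simp add: \<alpha>_coeff_def eval_nat_numeral del: fact_Suc power_Suc)
      also have "\<dots> = c * ((real (2 * j + 3) * real (2 * j + 2)) * \<alpha>\<^sup>2 * (- 1)
          / (2 ^ 4 * real (j + 1) * real (j + 3)))"
        unfolding f power_add c_def by (simp del: fact_Suc of_nat_add of_nat_mult of_nat_Suc add: mult_ac)
      also have "(real (2 * j + 3) * real (2 * j + 2)) * \<alpha>\<^sup>2 * (- 1)
          / (2 ^ 4 * real (j + 1) * real (j + 3)) = (1/2 - real (j + 2)) / real (j + 3) * (\<alpha> / 2)\<^sup>2"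
      proof -
        have "real (2 * j + 2) = 2 * real (j + 1)" "1/2 - real (j + 2) = - real (2 * j + 3) / 2"
          by simp_all
        then show ?thesis
          by (simp only:) (simp add: power_divide del: of_nat_add of_nat_mult of_nat_Suc)
      qed
      finally show ?thesis
        by (simp only: \<open>\<alpha>_coeff \<alpha> (j + 2) = c\<close>)
    qed
    also have "\<dots> = ((1/2) gchoose (j + 3)) * (\<alpha> / 2) ^ (2 * (j + 3))"
      unfolding Suc.IH
      using gbinomial_Suc_rec[of "1/2 :: real" "j + 2"]
      by (simp add: power2_eq_square eval_nat_numeral mult_ac)
    finally show ?case
      by (simp add: eval_nat_numeral)
  qed
  ultimately show ?thesis by simp
qed

lemma sqrt_taylor_bound:
  fixes x :: real
  assumes "0 \<le> x" "x \<le> 1 / 2"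
  shows "\<bar>sqrt (1 + x) - (\<Sum>k\<le>N. ((1/2) gchoose k) * x ^ k)\<bar> \<le> 2 * x ^ (N + 1)"
proof -
  define f where "f k = ((1/2 :: real) gchoose k) * x ^ k" for k
  have "f sums sqrt (1 + x)"
    unfolding f_def using assms by (intro sqrt_series) auto
  then have tail: "(\<lambda>k. f (k + Suc N)) sums (sqrt (1 + x) - (\<Sum>k\<le>N. f k))"
    by (simp only: sums_iff_shift lessThan_Suc_atMost diff_add_cancel)
  have "(\<lambda>k. x ^ Suc N * x ^ k) sums (x ^ Suc N * (1 / (1 - x)))"
    using assms by (intro sums_mult geometric_sums) auto
  then have geo: "(\<lambda>k. x ^ (k + Suc N)) sums (x ^ Suc N * (1 / (1 - x)))"
    by (simp add: power_add mult_ac)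
  have le: "\<bar>f k\<bar> \<le> x ^ k" for k
    using abs_half_gbinomial_le_1[of k] assms
    by (simp add: f_def abs_mult mult_left_le_one_le)
  have "sqrt (1 + x) - (\<Sum>k\<le>N. f k) \<le> x ^ Suc N * (1 / (1 - x))"
    using le by (intro sums_le[OF _ tail geo]) (meson abs_le_D1)
  moreover have "- (sqrt (1 + x) - (\<Sum>k\<le>N. f k)) \<le> x ^ Suc N * (1 / (1 - x))"
    using le by (intro sums_le[OF _ sums_minus[OF tail] geo]) (meson abs_le_D2)
  ultimately have "\<bar>sqrt (1 + x) - (\<Sum>k\<le>N. f k)\<bar> \<le> x ^ Suc N * (1 / (1 - x))"
    by linarith
  also have "\<dots> \<le> x ^ Suc N * 2"
    using assms by (intro mult_left_mono) (auto simp: field_simps)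
  finally show ?thesis
    by (simp add: f_def mult_ac)
qed

text \<open>
  The binomial series of \<open>sqrt (1 + x)\<close> at \<open>x = (\<beta>/(2 m))\<^sup>2\<close>, multiplied by \<open>m\<close>: the term
  \<open>m x\<^sup>k\<close> is \<open>(\<beta>/2) ^ (2 k)\<close> times \<open>m\<close> to the power \<open>1 - 2 k\<close>, which produces the odd powers.
\<close>
lemma scaled_sqrt_expansion:
  assumes "m > 0" "\<bar>\<beta>\<bar> \<le> m"
  shows "\<bar>m * sqrt (1 + (\<beta> / (2 * m))\<^sup>2) - (m + (\<Sum>k=1..N. \<alpha>_coeff \<beta> k / m ^ (2 * k - 1)))\<bar>
         \<le> 2 * (\<beta> / 2) ^ (2 * N + 2) * (1 / m ^ (2 * N + 1))"
proof -
  define x where "x = (\<beta> / (2 * m))\<^sup>2"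
  have xk: "m * x ^ k = (\<beta> / 2) ^ (2 * k) / m ^ (2 * k - 1)" if "k \<ge> 1" for k
  proof -
    have "m * x ^ k = (\<beta> / 2) ^ (2 * k) * (m / m ^ (2 * k))"
      by (simp add: x_def flip: power_mult divide_divide_eq_left)
         (simp add: power_divide)
    also have "m / m ^ (2 * k) = 1 / m ^ (2 * k - 1)"
      using that assms(1) by (simp add: power_diff field_simps)
    finally show ?thesis by simp
  qed
  have "\<bar>\<beta> / (2 * m)\<bar> \<le> 1 / 2"
    using assms by (simp add: field_simps)
  then have "x \<le> (1 / 2)\<^sup>2"
    unfolding x_def by (metis abs_ge_zero power2_abs power_mono)
  then have x: "0 \<le> x" "x \<le> 1 / 2"
    by (simp_all add: x_def power2_eq_square)
  have "m * (\<Sum>k\<le>N. ((1/2) gchoose k) * x ^ k)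
      = m + (\<Sum>k=1..N. m * (((1/2) gchoose k) * x ^ k))"
    by (simp add: atMost_atLeast0 sum.atLeast_Suc_atMost sum_distrib_left distrib_left)
  also have "(\<Sum>k=1..N. m * (((1/2) gchoose k) * x ^ k)) = (\<Sum>k=1..N. \<alpha>_coeff \<beta> k / m ^ (2 * k - 1))"
    using xk by (intro sum.cong) (simp_all add: \<alpha>_coeff_eq_gbinomial mult.left_commute[of m])
  finally have "m * sqrt (1 + x) - (m + (\<Sum>k=1..N. \<alpha>_coeff \<beta> k / m ^ (2 * k - 1)))
      = m * (sqrt (1 + x) - (\<Sum>k\<le>N. ((1/2) gchoose k) * x ^ k))"
    by (simp add: right_diff_distrib)
  also have "\<bar>\<dots>\<bar> \<le> m * (2 * x ^ (N + 1))"
    using sqrt_taylor_bound[OF x, of N] assms(1) by (simp add: abs_mult)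
  also have "\<dots> = 2 * (\<beta> / 2) ^ (2 * N + 2) * (1 / m ^ (2 * N + 1))"
    using xk[of "N + 1"] by simp
  finally show ?thesis by (simp add: x_def)
qed

section \<open>Asymptotics of the eigenvalues\<close>

text \<open>
  The exponent \<open>p\<close> is only required to be dominated by each of the three error orders \<open>\<epsilon>\<^sup>2\<close>,
  \<open>\<epsilon>/m\<close> and \<open>m powr (- (2 N + 1))\<close>, so that one statement serves both ranges of \<open>\<gamma>\<close>.
\<close>
lemma pair_root_asymptotics:
  fixes \<beta> \<gamma> s p :: real and \<mu> :: "nat \<Rightarrow> real"
  assumes "\<beta> \<noteq> 0" "\<gamma> < 0" "filterlim \<mu> at_top sequentially" "\<bar>s\<bar> = 1"
    and p: "p \<le> - 4 * \<gamma>" "p \<le> 1 - 2 * \<gamma>" "p \<le> 2 * real N + 1"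
  shows "(\<lambda>n. pair_root (\<mu> n) (pair_sum \<beta> (\<mu> n powr (2 * \<gamma>))) s
            - (s * \<i> * \<mu> n + \<i> * \<beta> / 2
               + s * \<i> * (\<Sum>k=1..N. \<alpha>_coeff \<beta> k / \<mu> n ^ (2 * k - 1))
               - 1 / (4 * \<mu> n powr (- 2 * \<gamma>))))
         \<in> O(\<lambda>n. complex_of_real (1 / \<mu> n powr p))"
proof -
  define K\<^sub>1 where "K\<^sub>1 = 1 / (8 * \<bar>\<beta>\<bar>)"
  define K\<^sub>2 where "K\<^sub>2 = (\<bar>\<beta>\<bar> + 1 / 2 + 1 / (4 * \<bar>\<beta>\<bar>)) / 4"
  define K\<^sub>3 where "K\<^sub>3 = 2 * (\<beta> / 2) ^ (2 * N + 2)"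
  have K: "K\<^sub>1 \<ge> 0" "K\<^sub>2 \<ge> 0" "K\<^sub>3 \<ge> 0"
    using zero_le_even_power[of "2 * N + 2" "\<beta> / 2"] by (simp_all add: K\<^sub>1_def K\<^sub>2_def K\<^sub>3_def del: power_Suc)
  have bound: "cmod (pair_root m (pair_sum \<beta> (m powr (2 * \<gamma>))) s
       - (s * \<i> * m + \<i> * \<beta> / 2 + s * \<i> * (\<Sum>k=1..N. \<alpha>_coeff \<beta> k / m ^ (2 * k - 1))
          - 1 / (4 * m powr (- 2 * \<gamma>))))
     \<le> (K\<^sub>1 + K\<^sub>2 + K\<^sub>3) * (1 / m powr p)" if "m \<ge> 1" "m \<ge> \<bar>\<beta>\<bar>" for m :: real
  proof -
    define \<epsilon> where "\<epsilon> = m powr (2 * \<gamma>)"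
    define S where "S = (\<Sum>k=1..N. \<alpha>_coeff \<beta> k / m ^ (2 * k - 1))"
    define R where "R = m * sqrt (1 + (\<beta> / (2 * m))\<^sup>2)"
    define w where "w = pair_sum \<beta> \<epsilon>"
    have "m > 0" using that by simp
    have \<epsilon>: "0 \<le> \<epsilon>" "\<epsilon> \<le> 1" and \<epsilon>_eq: "1 / (4 * m powr (- 2 * \<gamma>)) = \<epsilon> / 4"
      using that(1) \<open>\<gamma> < 0\<close> powr_mono[of "2 * \<gamma>" 0 m]
      by (simp_all add: \<epsilon>_def powr_minus_divide)
    have "\<epsilon>\<^sup>2 = m powr (4 * \<gamma>)" "\<epsilon> / m = m powr (2 * \<gamma> - 1)"
      using \<open>m > 0\<close> by (simp_all add: \<epsilon>_def powr_powr powr_diff flip: powr_numeral)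
    moreover have "1 / m ^ (2 * N + 1) = m powr (- (2 * real N + 1))"
    proof -
      have "m powr (2 * real N + 1) = m powr real (2 * N + 1)"
        by (simp add: add.commute)
      then show ?thesis
        using powr_realpow[OF \<open>m > 0\<close>, of "2 * N + 1"] by (simp only: powr_minus_divide)
    qed
    moreover have "m powr q \<le> 1 / m powr p" if "q \<le> - p" for q
      using powr_mono[OF that \<open>m \<ge> 1\<close>] by (simp add: powr_minus_divide)
    ultimately have small: "\<epsilon>\<^sup>2 \<le> 1 / m powr p" "\<epsilon> / m \<le> 1 / m powr p"
        "1 / m ^ (2 * N + 1) \<le> 1 / m powr p"
      using p by simp_all
    have "cmod (pair_root m w s - (s * \<i> * R + \<i> * \<beta> / 2 - \<epsilon> / 4)) \<le> K\<^sub>1 * \<epsilon>\<^sup>2 + K\<^sub>2 * (\<epsilon> / m)"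
      using pair_root_approx[OF \<open>\<beta> \<noteq> 0\<close> \<epsilon> \<open>m > 0\<close> \<open>\<bar>s\<bar> = 1\<close>]
      by (simp add: w_def R_def K\<^sub>1_def K\<^sub>2_def mult.assoc)
    moreover have "cmod (s * \<i> * of_real (R - (m + S))) \<le> K\<^sub>3 * (1 / m ^ (2 * N + 1))"
      using scaled_sqrt_expansion[OF \<open>m > 0\<close> that(2), of N] \<open>\<bar>s\<bar> = 1\<close>
      unfolding R_def S_def K\<^sub>3_def norm_mult norm_of_real norm_ii by simp
    moreover have "pair_root m w s - (s * \<i> * m + \<i> * \<beta> / 2 + s * \<i> * S - \<epsilon> / 4)
        = (pair_root m w s - (s * \<i> * R + \<i> * \<beta> / 2 - \<epsilon> / 4)) + s * \<i> * of_real (R - (m + S))"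
      by (simp add: algebra_simps)
    ultimately have "cmod (pair_root m w s - (s * \<i> * m + \<i> * \<beta> / 2 + s * \<i> * S - \<epsilon> / 4))
        \<le> K\<^sub>1 * \<epsilon>\<^sup>2 + K\<^sub>2 * (\<epsilon> / m) + K\<^sub>3 * (1 / m ^ (2 * N + 1))"
      by (smt (verit) norm_triangle_ineq)
    also have "\<dots> \<le> K\<^sub>1 * (1 / m powr p) + K\<^sub>2 * (1 / m powr p) + K\<^sub>3 * (1 / m powr p)"
      using small K by (intro add_mono mult_left_mono)
    finally show ?thesis
      by (simp only: \<epsilon>_eq w_def S_def \<epsilon>_def distrib_right)
  qed
  have "eventually (\<lambda>n. \<mu> n \<ge> max 1 \<bar>\<beta>\<bar>) sequentially"
    using assms(3) unfolding filterlim_at_top by blast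
  then show ?thesis
    by (intro bigoI[where c = "K\<^sub>1 + K\<^sub>2 + K\<^sub>3"], elim eventually_mono)
       (use bound in \<open>simp add: norm_divide norm_powr_real_powr\<close>)
qed

lemma \<alpha>_coeff_minus: "\<alpha>_coeff (- \<alpha>) k = \<alpha>_coeff \<alpha> k"
  by (simp add: \<alpha>_coeff_def)

theorem lemma4p2:
  fixes D :: "'h::complex_hilbert set" and A :: "'h \<Rightarrow> 'h"
    and e :: "nat \<Rightarrow> 'h" and \<mu> :: "nat \<Rightarrow> real"
    and a \<gamma> \<alpha> :: real and N :: nat
  assumes "infinite_dimensional TYPE('h)"
    and "separable_space (euclidean :: 'h topology)"
    and "self_adjoint D A" and "coercive D A"
    and "compact_resolvent D A" and "simple_spectrum D A"
    and "orthonormal_basis e"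
    and "strict_mono \<mu>" and "\<And>n. \<mu> n > 0" and "filterlim \<mu> at_top sequentially"
    and "\<And>n. e n \<in> D \<and> A (e n) = complex_of_real ((\<mu> n)\<^sup>2) *\<^sub>C e n"
    and "\<alpha> \<noteq> 0" and "a = 1" and "\<gamma> < 0"
    and "int N = \<lfloor>1/2 - \<gamma>\<rfloor>"
  shows "\<exists>\<Lambda>\<^sub>1 \<Lambda>\<^sub>2 :: real \<Rightarrow> nat \<Rightarrow> complex.
    (\<forall>n. {#\<Lambda>\<^sub>1 1 n, \<Lambda>\<^sub>1 (-1) n, \<Lambda>\<^sub>2 1 n, \<Lambda>\<^sub>2 (-1) n#} = proots (characteristic_poly a \<gamma> \<alpha> (\<mu> n)) \<and>
         {\<Lambda>\<^sub>1 1 n, \<Lambda>\<^sub>1 (-1) n, \<Lambda>\<^sub>2 1 n, \<Lambda>\<^sub>2 (-1) n} = system_eigenvalues a \<gamma> \<alpha> D A e \<mu> n) \<and>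
    (\<forall>s\<in>{1, -1}.
      (0 < - 2 * \<gamma> \<and> - 2 * \<gamma> < 1 \<longrightarrow>
        (\<lambda>n. \<Lambda>\<^sub>1 s n - (s * \<i> * \<mu> n + \<i> * \<alpha> / 2 - 1 / (4 * \<mu> n powr (- 2 * \<gamma>))))
          \<in> O(\<lambda>n. complex_of_real (1 / \<mu> n powr min 1 (- 4 * \<gamma>))) \<and>
        (\<lambda>n. \<Lambda>\<^sub>2 s n - (s * \<i> * \<mu> n - \<i> * \<alpha> / 2 - 1 / (4 * \<mu> n powr (- 2 * \<gamma>))))
          \<in> O(\<lambda>n. complex_of_real (1 / \<mu> n powr min 1 (- 4 * \<gamma>)))) \<and>
      (- 2 * \<gamma> \<ge> 1 \<longrightarrow>
        (\<lambda>n. \<Lambda>\<^sub>1 s n - (s * \<i> * \<mu> n + \<i> * \<alpha> / 2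
               + s * \<i> * (\<Sum>k=1..N. \<alpha>_coeff \<alpha> k / \<mu> n ^ (2 * k - 1))
               - 1 / (4 * \<mu> n powr (- 2 * \<gamma>))))
          \<in> O(\<lambda>n. complex_of_real (1 / \<mu> n powr min (2 * real N + 1) (1 - 2 * \<gamma>))) \<and>
        (\<lambda>n. \<Lambda>\<^sub>2 s n - (s * \<i> * \<mu> n - \<i> * \<alpha> / 2
               + s * \<i> * (\<Sum>k=1..N. \<alpha>_coeff \<alpha> k / \<mu> n ^ (2 * k - 1))
               - 1 / (4 * \<mu> n powr (- 2 * \<gamma>))))
          \<in> O(\<lambda>n. complex_of_real (1 / \<mu> n powr min (2 * real N + 1) (1 - 2 * \<gamma>)))))"
proof -
  define w where "w = (\<lambda>\<beta> n. pair_sum \<beta> (\<mu> n powr (2 * \<gamma>)))"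
  define \<Lambda> where "\<Lambda> = (\<lambda>\<beta> s n. pair_root (\<mu> n) (w \<beta> n) s)"
  have roots: "{#\<Lambda> \<alpha> 1 n, \<Lambda> \<alpha> (- 1) n, \<Lambda> (- \<alpha>) 1 n, \<Lambda> (- \<alpha>) (- 1) n#}
      = proots (characteristic_poly a \<gamma> \<alpha> (\<mu> n))" for n
    using assms(9)[of n] \<open>\<alpha> \<noteq> 0\<close> \<open>a = 1\<close>
    by (simp add: proots_characteristic_poly \<Lambda>_def w_def)
  have eigenvalues: "{\<Lambda> \<alpha> 1 n, \<Lambda> \<alpha> (- 1) n, \<Lambda> (- \<alpha>) 1 n, \<Lambda> (- \<alpha>) (- 1) n}
      = system_eigenvalues a \<gamma> \<alpha> D A e \<mu> n" for n
  proof -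
    have "poly (characteristic_poly a \<gamma> \<alpha> (\<mu> n)) 0 \<noteq> 0"
      using assms(9)[of n] \<open>a = 1\<close> by (simp add: poly_characteristic_poly)
    then have "characteristic_poly a \<gamma> \<alpha> (\<mu> n) \<noteq> 0"
      by auto
    then have "{l. poly (characteristic_poly a \<gamma> \<alpha> (\<mu> n)) l = 0}
        = {\<Lambda> \<alpha> 1 n, \<Lambda> \<alpha> (- 1) n, \<Lambda> (- \<alpha>) 1 n, \<Lambda> (- \<alpha>) (- 1) n}"
      by (simp flip: set_count_proots roots)
    then show ?thesis
      using system_eigenvalues_eq_roots[of D A e n \<mu> \<alpha> a \<gamma>] assms
      by (simp add: self_adjoint_def)
  qed
  have expansion: "(\<lambda>n. \<Lambda> \<beta> s n - (s * \<i> * \<mu> n + \<i> * \<beta> / 2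
               + s * \<i> * (\<Sum>k=1..N. \<alpha>_coeff \<beta> k / \<mu> n ^ (2 * k - 1))
               - 1 / (4 * \<mu> n powr (- 2 * \<gamma>))))
          \<in> O(\<lambda>n. complex_of_real (1 / \<mu> n powr p))"
    if "\<beta> \<noteq> 0" "s \<in> {1, -1}" "p \<le> - 4 * \<gamma>" "p \<le> 1 - 2 * \<gamma>" "p \<le> 2 * real N + 1" for \<beta> s p
    unfolding \<Lambda>_def w_def
    by (rule pair_root_asymptotics[OF that(1) assms(14) assms(10) _ that(3-5)]) (use that(2) in auto)
  \<comment> \<open>In the first range of \<open>\<gamma>\<close> the correction sum in \<open>expansion\<close> is empty.\<close>
  have N0: "N = 0" if "- 2 * \<gamma> < 1"
    using assms(14,15) that by linarith
  show ?thesis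
  proof (rule exI[of _ "\<Lambda> \<alpha>"], rule exI[of _ "\<Lambda> (- \<alpha>)"], intro conjI allI ballI impI roots eigenvalues,
      goal_cases)
    case (1 s)
    then show ?case
      using expansion[of \<alpha> s "min 1 (- 4 * \<gamma>)"] N0 assms(12,14) by simp
  next
    case (2 s)
    then show ?case
      using expansion[of "- \<alpha>" s "min 1 (- 4 * \<gamma>)"] N0 assms(12,14) by simp
  next
    case (3 s)
    then show ?case
      using expansion[of \<alpha> s "min (2 * real N + 1) (1 - 2 * \<gamma>)"] assms(12) by simp
  next
    case (4 s)
    then show ?case
      using expansion[of "- \<alpha>" s "min (2 * real N + 1) (1 - 2 * \<gamma>)"] assms(12)
      by (simp add: \<alpha>_coeff_minus)
  qed
qed

end
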